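(* Let $k \geq 3$, $e \geq 2$ and $t\ge1$ be integers. If $M$ is a $k$-nestable ordered $k$-uniform matching with $e$ edges, then \[ R_{<,t}(M) \leq (ek)^{(2e-1)^{t-1}} = 2^{(2e-1)^{t-1}\log_2(ek)}. \]
   Context: An ordered hypergraph $G$ is contained in an ordered hypergraph $H$ if there is an injective order-preserving map $V(G)\to V(H)$ sending every edge of $G$ to an edge of $H$. $K_N^k$ is the complete $k$-uniform hypergraph on $[N]=\{1,\dots,N\}$ with the natural order. $R_{<,t}(G)$ is the least $N$ such that every coloring $c:E(K_N^k)\to[t]$ has a color class containing $G$. An ordered $k$-uniform matching $M$ with $e$ edges on vertex set $[ke]$ (pairwise disjoint edges covering $[ke]$) is $k$-nestable if there exist pairwise disjoint intervals $I_1,\dots,I_k$ of integers (some possibly empty or single points), consecutive in this order, whose union is $[ke]$, with $1\in I_1$ and $ke\in I_k$, such that every edge of $M$ either is contained in some $I_j$ or meets every one of $I_1,\dots,I_k$, and for each $j\in[k]$ the edges contained in $I_j$ form a matching that is either empty or (after order-preserving relabeling of its vertex set) itself $k$-nestable. This definition is recursive. *)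

theory Defs
  imports Complex_Main "HOL-Library.Ramsey" "HOL-Library.Disjoint_Sets"
begin

text \<open>An ordered hypergraph is a pair of a vertex set and an edge set; the order on the
  vertices is that of the vertex type.\<close>

type_synonym 'a hypergraph = "'a set \<times> 'a set set"

definition contained_in :: "'a::linorder hypergraph \<Rightarrow> 'b::linorder hypergraph \<Rightarrow> bool" where
  "contained_in G H \<longleftrightarrow>
     (\<exists>f. f ` fst G \<subseteq> fst H \<and> inj_on f (fst G) \<and> mono_on (fst G) f \<and> (\<forall>A \<in> snd G. f ` A \<in> snd H))"

definition complete_hypergraph :: "nat \<Rightarrow> nat \<Rightarrow> nat hypergraph" where
  "complete_hypergraph k N = ({1..N}, [{1..N}]\<^bsup>k\<^esup>)"

definition colour_class :: "'a hypergraph \<Rightarrow> ('a set \<Rightarrow> nat) \<Rightarrow> nat \<Rightarrow> 'a hypergraph" where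
  "colour_class H c i = (fst H, {A \<in> snd H. c A = i})"

definition ramsey_arrow :: "nat \<Rightarrow> nat \<Rightarrow> 'a::linorder hypergraph \<Rightarrow> nat \<Rightarrow> bool" where
  "ramsey_arrow k t G N \<longleftrightarrow>
     (\<forall>c \<in> snd (complete_hypergraph k N) \<rightarrow> {1..t}.
        \<exists>i \<in> {1..t}. contained_in G (colour_class (complete_hypergraph k N) c i))"

text \<open>For \<open>t \<ge> 1\<close> and a finite \<open>k\<close>-uniform \<open>G\<close> the least number exists, see
  \<open>ramsey_arrow_exists\<close> below.\<close>

definition ordered_ramsey :: "nat \<Rightarrow> nat \<Rightarrow> 'a::linorder hypergraph \<Rightarrow> nat" where
  "ordered_ramsey k t G = (LEAST N. ramsey_arrow k t G N)"

definition ordered_matching :: "nat \<Rightarrow> nat \<Rightarrow> nat hypergraph \<Rightarrow> bool" where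
  "ordered_matching k e M \<longleftrightarrow>
     fst M = {1..k * e} \<and> partition_on {1..k * e} (snd M) \<and>
     (\<forall>A \<in> snd M. card A = k) \<and> card (snd M) = e"

definition consecutive_intervals :: "nat \<Rightarrow> (nat \<Rightarrow> nat set) \<Rightarrow> nat \<Rightarrow> bool" where
  "consecutive_intervals k I n \<longleftrightarrow>
     (\<forall>j \<in> {1..k}. \<exists>a b. I j = {a..b}) \<and>
     disjoint_family_on I {1..k} \<and>
     (\<forall>i \<in> {1..k}. \<forall>j \<in> {1..k}. i < j \<longrightarrow> (\<forall>x \<in> I i. \<forall>y \<in> I j. x < y)) \<and>
     (\<Union>j \<in> {1..k}. I j) = {1..n}"

text \<open>For finite \<open>A\<close>, \<open>rank_in A\<close> is the order isomorphism from \<open>A\<close> onto \<open>{1..card A}\<close>, see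
  \<open>strict_mono_on_rank_in\<close> and \<open>rank_in_image\<close> below.\<close>

definition rank_in :: "nat set \<Rightarrow> nat \<Rightarrow> nat" where
  "rank_in A v = card {u \<in> A. u \<le> v}"

definition relabel :: "nat set set \<Rightarrow> nat hypergraph" where
  "relabel F = (rank_in (\<Union>F) ` \<Union>F, (`) (rank_in (\<Union>F)) ` F)"

text \<open>The recursive definition is read as a least fixed point. For \<open>k \<ge> 2\<close> it is well-founded:
  \<open>I 1\<close> and \<open>I k\<close> are both nonempty, so no \<open>I j\<close> contains all edges.\<close>

inductive nestable :: "nat \<Rightarrow> nat hypergraph \<Rightarrow> bool" for k :: nat where
  nestableI:
    "ordered_matching k e M \<Longrightarrow>
     consecutive_intervals k I (k * e) \<Longrightarrow>
     1 \<in> I 1 \<Longrightarrow> k * e \<in> I k \<Longrightarrow>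
     (\<And>A. A \<in> snd M \<Longrightarrow> (\<exists>j \<in> {1..k}. A \<subseteq> I j) \<or> (\<forall>j \<in> {1..k}. A \<inter> I j \<noteq> {})) \<Longrightarrow>
     (\<And>j. j \<in> {1..k} \<Longrightarrow>
        {A \<in> snd M. A \<subseteq> I j} = {} \<or> nestable k (relabel {A \<in> snd M. A \<subseteq> I j})) \<Longrightarrow>
     nestable k M"

lemma strict_mono_on_rank_in:
  assumes "finite A"
  shows "strict_mono_on A (rank_in A)"
proof (rule strict_mono_onI)
  fix x y assume xy: "x \<in> A" "y \<in> A" "x < y"
  have "{u \<in> A. u \<le> x} \<subset> {u \<in> A. u \<le> y}" using xy by force
  then show "rank_in A x < rank_in A y"
    unfolding rank_in_def using assms by (intro psubset_card_mono) auto
qed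

lemma rank_in_image:
  assumes "finite A"
  shows "rank_in A ` A = {1..card A}"
proof (rule card_subset_eq)
  show "rank_in A ` A \<subseteq> {1..card A}"
  proof
    fix n assume "n \<in> rank_in A ` A"
    then obtain v where v: "v \<in> A" "n = card {u \<in> A. u \<le> v}" by (auto simp: rank_in_def)
    have "n \<le> card A" unfolding v(2) using assms by (intro card_mono) auto
    moreover have "n > 0" unfolding v(2) using assms v(1) by (subst card_gt_0_iff) auto
    ultimately show "n \<in> {1..card A}" by simp
  qed
  show "card (rank_in A ` A) = card {1..card A}"
    using strict_mono_on_imp_inj_on[OF strict_mono_on_rank_in[OF assms]] by (simp add: card_image)
qed simp

lemma ramsey_arrow_exists:
  fixes G :: "nat hypergraph"
  assumes V: "finite (fst G)" and E: "\<And>A. A \<in> snd G \<Longrightarrow> A \<subseteq> fst G \<and> card A = k" and "t \<ge> 1"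
  shows "\<exists>N. ramsey_arrow k t G N"
proof -
  define m where "m = card (fst G)"
  obtain N :: nat where N: "partn_lst {..<N} (replicate t m) k" using ramsey_full[of "replicate t m" k] by blast
  have "ramsey_arrow k t G N"
    unfolding ramsey_arrow_def
  proof
    fix c assume c: "c \<in> snd (complete_hypergraph k N) \<rightarrow> {1..t}"
    define d where "d B = c (Suc ` B) - 1" for B
    have img: "Suc ` B \<in> [{1..N}]\<^bsup>k\<^esup>" if "B \<in> [{..<N}]\<^bsup>k\<^esup>" for B
      using that by (auto simp: nsets_def card_image Suc_le_eq)
    have cS: "c (Suc ` B) \<in> {1..t}" if "B \<in> [{..<N}]\<^bsup>k\<^esup>" for B
      using c img[OF that] by (auto simp: complete_hypergraph_def)
    have "d B < t" if "B \<in> [{..<N}]\<^bsup>k\<^esup>" for B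
      using cS[OF that] by (auto simp: d_def)
    then have "d \<in> [{..<N}]\<^bsup>k\<^esup> \<rightarrow> {..<length (replicate t m)}" by simp
    then obtain i H where i: "i < t" and H: "H \<in> [{..<N}]\<^bsup>m\<^esup>" and mono: "d ` [H]\<^bsup>k\<^esup> \<subseteq> {i}"
      using N by (fastforce simp: partn_lst_def monochromatic_def)
    have H': "H \<subseteq> {..<N}" "finite H" "card H = m" using H by (auto simp: nsets_def)
    define g where "g = inv_into H (rank_in H)"
    define f where "f v = Suc (g (rank_in (fst G) v))" for v
    have gH: "g n \<in> H \<and> rank_in H (g n) = n" if "n \<in> {1..m}" for n
      using that rank_in_image[OF H'(2)] H'(3) unfolding g_def
      by (metis f_inv_into_f inv_into_into)
    have rG: "rank_in (fst G) v \<in> {1..m}" if "v \<in> fst G" for v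
      using that rank_in_image[OF V] unfolding m_def by blast
    have fH: "f v \<in> Suc ` H" if "v \<in> fst G" for v
      using gH rG[OF that] unfolding f_def by blast
    have sm: "strict_mono_on (fst G) f"
    proof (rule strict_mono_onI)
      fix x y assume xy: "x \<in> fst G" "y \<in> fst G" "x < y"
      have "rank_in (fst G) x < rank_in (fst G) y"
        using strict_mono_onD[OF strict_mono_on_rank_in[OF V]] xy by blast
      then have "rank_in H (g (rank_in (fst G) x)) < rank_in H (g (rank_in (fst G) y))"
        using gH rG xy by presburger
      then have "g (rank_in (fst G) x) < g (rank_in (fst G) y)"
        using strict_mono_on_less[OF strict_mono_on_rank_in[OF H'(2)]] gH rG xy by blast
      then show "f x < f y" by (simp add: f_def)
    qed
    have inj: "inj_on f (fst G)" using sm by (rule strict_mono_on_imp_inj_on)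
    have edge: "f ` A \<in> [{1..N}]\<^bsup>k\<^esup> \<and> c (f ` A) = Suc i" if "A \<in> snd G" for A
    proof -
      have "f ` A \<subseteq> Suc ` H" using fH E[OF that] by blast
      then obtain B where B: "B \<subseteq> H" "f ` A = Suc ` B" by (meson subset_imageE)
      have "card (f ` A) = k" using E[OF that] inj by (metis card_image inj_on_subset)
      then have Bk: "B \<in> [H]\<^bsup>k\<^esup>"
        using B H'(2) finite_subset by (auto simp: nsets_def card_image)
      then have BN: "B \<in> [{..<N}]\<^bsup>k\<^esup>" using H'(1) by (auto simp: nsets_def)
      show ?thesis using img[OF BN] cS[OF BN] mono Bk B(2) by (force simp: d_def)
    qed
    have "contained_in G (colour_class (complete_hypergraph k N) c (Suc i))"
      unfolding contained_in_def colour_class_def complete_hypergraph_def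
      using inj strict_mono_on_imp_mono_on[OF sm] fH H'(1) edge
      by (intro exI[of _ f]) (fastforce simp: Suc_le_eq)
    then show "\<exists>i\<in>{1..t}. contained_in G (colour_class (complete_hypergraph k N) c i)"
      using i by (intro bexI[of _ "Suc i"]) auto
  qed
  then show ?thesis ..
qed

end

(* Let n be a Ramsey number of M for t colours, and call colour t + 1 red. Cut an interval of
   n * g points into n blocks of length g. If every k-tuple of blocks has a transversal that is not
   red, colour the k-tuple by the colour of such a transversal: the n blocks then contain a
   monochromatic copy of M, and since M is a matching, the representatives of the blocks may be
   chosen separately for each edge, which gives a copy of M in a colour other than red. Otherwise
   some k blocks span only red transversals. These serve as the intervals of a nestable matching
   with e' edges: its crossing edges are red automatically, and the matchings inside the intervals,
   which have at most e' - 1 edges, are found by induction within the blocks, leaving gaps of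
   length n for the vertices of the crossing edges. So each edge costs a factor n^2. *)

theory Submission
  imports Defs
begin

section \<open>Copies of ordered hypergraphs in coloured initial segments\<close>

definition has_copy :: "(nat set \<Rightarrow> nat) \<Rightarrow> nat \<Rightarrow> nat hypergraph \<Rightarrow> nat \<Rightarrow> bool" where
  "has_copy c i G N \<longleftrightarrow>
     (\<exists>f. strict_mono_on (fst G) f \<and> f ` fst G \<subseteq> {..<N} \<and> (\<forall>A \<in> snd G. c (f ` A) = i))"

text \<open>Colourings are total on \<open>nat set\<close>, not just on \<open>k\<close>-sets of the
  segment, so composing one with the image map of an embedding gives a colouring again, with no
  domain to track.\<close>

definition arrows :: "nat \<Rightarrow> nat hypergraph \<Rightarrow> nat \<Rightarrow> bool" where
  "arrows t G N \<longleftrightarrow> (\<forall>c. range c \<subseteq> {1..t} \<longrightarrow> (\<exists>i \<in> {1..t}. has_copy c i G N))"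

text \<open>Carries copies found for a transported colouring on a short segment back to the long
  one; this is how the induction is applied inside a block.\<close>

lemma has_copy_pullback:
  assumes "has_copy (\<lambda>A. c (h ` A)) i G m"
    and h: "strict_mono_on {..<m} h" "h ` {..<m} \<subseteq> {..<N}"
  shows "has_copy c i G N"
proof -
  obtain f where f: "strict_mono_on (fst G) f" "f ` fst G \<subseteq> {..<m}"
      "\<forall>A \<in> snd G. c (h ` f ` A) = i"
    using assms(1) by (auto simp: has_copy_def)
  have "strict_mono_on (fst G) (h \<circ> f)"
  proof (rule strict_mono_onI)
    fix x y assume xy: "x \<in> fst G" "y \<in> fst G" "x < y"
    then have "f x < f y" using f(1) by (simp add: strict_mono_onD)
    then show "(h \<circ> f) x < (h \<circ> f) y"
      using xy f(2) strict_mono_onD[OF h(1)] by (simp add: image_subset_iff)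
  qed
  moreover have "(h \<circ> f) ` fst G \<subseteq> {..<N}" using f(2) h(2) by (auto simp: image_subset_iff)
  moreover have "\<forall>A \<in> snd G. c ((h \<circ> f) ` A) = i" using f(3) by (simp add: image_comp)
  ultimately show ?thesis unfolding has_copy_def by blast
qed

lemma has_copy_relabelD:
  assumes "has_copy c i (relabel F) N" "finite (\<Union>F)"
  shows "has_copy c i (\<Union>F, F) N"
proof -
  let ?r = "rank_in (\<Union>F)"
  obtain f where f: "strict_mono_on (?r ` \<Union>F) f" "f ` ?r ` \<Union>F \<subseteq> {..<N}"
      "\<forall>A \<in> F. c (f ` ?r ` A) = i"
    using assms(1) by (auto simp: has_copy_def relabel_def)
  have "strict_mono_on (\<Union>F) (f \<circ> ?r)"
  proof (rule strict_mono_onI)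
    fix x y assume xy: "x \<in> \<Union>F" "y \<in> \<Union>F" "x < y"
    then have "?r x < ?r y" using strict_mono_onD[OF strict_mono_on_rank_in[OF assms(2)]] by blast
    then show "(f \<circ> ?r) x < (f \<circ> ?r) y"
      using xy(1,2) strict_mono_onD[OF f(1), of "?r x" "?r y"] by simp
  qed
  moreover have "(f \<circ> ?r) ` \<Union>F \<subseteq> {..<N}" using f(2) by (simp add: image_comp)
  moreover have "\<forall>A \<in> F. c ((f \<circ> ?r) ` A) = i" using f(3) by (simp add: image_comp)
  ultimately show ?thesis unfolding has_copy_def fst_conv snd_conv by blast
qed

lemma ramsey_arrow_if_arrows:
  assumes arr: "arrows t M N" and M: "ordered_matching k e M" and "t \<ge> 1"
  shows "ramsey_arrow k t M N"
  unfolding ramsey_arrow_def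
proof
  fix c assume c: "c \<in> snd (complete_hypergraph k N) \<rightarrow> {1..t}"
  \<comment> \<open>The shift by \<open>Suc\<close> passes from \<open>{..<N}\<close> to
    \<open>{1..N}\<close>. Sets that do not become edges get 1, a legal colour because
    \<open>t\<close> is positive.\<close>
  define d where "d B = (if Suc ` B \<in> [{1..N}]\<^bsup>k\<^esup> then c (Suc ` B) else 1)" for B
  have "range d \<subseteq> {1..t}"
    using c \<open>t \<ge> 1\<close> by (auto simp: d_def complete_hypergraph_def Pi_iff)
  then obtain i f where i: "i \<in> {1..t}" and f: "strict_mono_on (fst M) f" "f ` fst M \<subseteq> {..<N}"
      "\<forall>A \<in> snd M. d (f ` A) = i"
    using arr unfolding arrows_def has_copy_def by meson
  define g where "g v = Suc (f v)" for v
  have g: "strict_mono_on (fst M) g"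
    using f(1) by (simp add: strict_mono_on_def g_def)
  have inj: "inj_on g (fst M)" using g by (rule strict_mono_on_imp_inj_on)
  have gr: "g ` fst M \<subseteq> {1..N}" using f(2) by (auto simp: g_def)
  have edge: "g ` A \<in> [{1..N}]\<^bsup>k\<^esup> \<and> c (g ` A) = i" if A: "A \<in> snd M" for A
  proof -
    have AV: "A \<subseteq> fst M" "card A = k"
      using M A by (auto simp: ordered_matching_def partition_on_def)
    have "finite A" using AV(1) M finite_subset by (auto simp: ordered_matching_def)
    then have "g ` A \<in> [{1..N}]\<^bsup>k\<^esup>"
      using AV gr inj by (auto simp: nsets_def card_image inj_on_subset)
    moreover have "g ` A = Suc ` f ` A" by (auto simp: g_def)
    ultimately show ?thesis using f(3) A by (metis d_def)
  qed
  have "contained_in M (colour_class (complete_hypergraph k N) c i)"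
    unfolding contained_in_def colour_class_def complete_hypergraph_def
    using inj gr edge strict_mono_on_imp_mono_on[OF g] by (intro exI[of _ g]) auto
  then show "\<exists>i\<in>{1..t}. contained_in M (colour_class (complete_hypergraph k N) c i)"
    using i by blast
qed

section \<open>Blocks and their transversals\<close>

lemma block_less:
  fixes p q g x y :: nat
  assumes "p < q" "x < Suc p * g" "q * g \<le> y"
  shows "x < y"
proof -
  have "Suc p * g \<le> q * g" using assms(1) by (intro mult_le_mono1) simp
  then show ?thesis using assms by linarith
qed

lemma red_blocks_or_copy:
  assumes c: "range c \<subseteq> {1..Suc t}" and arr: "arrows t M n" and M: "ordered_matching k e M"
    and "t \<ge> 1"
  shows "(\<exists>i \<in> {1..t}. has_copy c i M (n * g)) \<or>
    (\<exists>Q \<subseteq> {..<n}. card Q = k \<and>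
       (\<forall>u. (\<forall>q \<in> Q. u q \<in> {q * g..<Suc q * g}) \<longrightarrow> c (u ` Q) = Suc t))"
proof (rule disjCI)
  assume no: "\<not> (\<exists>Q \<subseteq> {..<n}. card Q = k \<and>
       (\<forall>u. (\<forall>q \<in> Q. u q \<in> {q * g..<Suc q * g}) \<longrightarrow> c (u ` Q) = Suc t))"
  then obtain u where u: "\<And>Q. Q \<subseteq> {..<n} \<Longrightarrow> card Q = k \<Longrightarrow>
      (\<forall>q \<in> Q. u Q q \<in> {q * g..<Suc q * g}) \<and> c (u Q ` Q) \<noteq> Suc t"
    by metis
  \<comment> \<open>Red never occurs as a value: for a \<open>k\<close>-set \<open>Q\<close> of
    blocks the colour is that of the non-red transversal \<open>u Q\<close>, and all other sets get
    the dummy colour 1.\<close>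
  define d where "d Q = (if Q \<subseteq> {..<n} \<and> card Q = k then c (u Q ` Q) else 1)" for Q
  have "d Q \<in> {1..t}" for Q
    using u[of Q] c \<open>t \<ge> 1\<close> by (auto simp: d_def image_subset_iff le_Suc_eq)
  then have "range d \<subseteq> {1..t}" by blast
  then obtain i f where i: "i \<in> {1..t}" and f: "strict_mono_on (fst M) f" "f ` fst M \<subseteq> {..<n}"
      "\<forall>A \<in> snd M. d (f ` A) = i"
    using arr unfolding arrows_def has_copy_def by meson
  have P: "partition_on (fst M) (snd M)" and Mk: "\<And>A. A \<in> snd M \<Longrightarrow> card A = k"
    using M by (auto simp: ordered_matching_def)
  have sub: "A \<subseteq> fst M" if "A \<in> snd M" for A
    using P that by (auto simp: partition_on_def)
  have "\<exists>A. A \<in> snd M \<and> v \<in> A" if "v \<in> fst M" for v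
    using P that by (auto simp: partition_on_def)
  then obtain E where E: "\<And>v. v \<in> fst M \<Longrightarrow> E v \<in> snd M \<and> v \<in> E v" by metis
  have E_eq: "E v = A" if "v \<in> A" "A \<in> snd M" for v A
  proof -
    have "disjoint (snd M)" using P by (simp add: partition_on_def)
    then show ?thesis using E[of v] that sub by (meson disjointD disjoint_iff subsetD)
  qed
  have edge: "f ` A \<subseteq> {..<n}" "card (f ` A) = k" if "A \<in> snd M" for A
    using sub[OF that] f(2) Mk[OF that] strict_mono_on_imp_inj_on[OF f(1)]
    by (auto simp: card_image inj_on_subset)
  \<comment> \<open>In the block \<open>f v\<close> the representative is the one used by the
    transversal for the edge through \<open>v\<close>. That edge is unique, so \<open>F\<close> is
    well defined.\<close>
  define F where "F v = u (f ` E v) (f v)" for v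
  have F: "f v * g \<le> F v" "F v < Suc (f v) * g" if "v \<in> fst M" for v
    using u[OF edge[of "E v"]] E[OF that] by (auto simp: F_def)
  \<comment> \<open>Distinct vertices lie in distinct blocks, so the order does not depend on which
    representatives were chosen.\<close>
  have "strict_mono_on (fst M) F"
  proof (rule strict_mono_onI)
    fix x y assume xy: "x \<in> fst M" "y \<in> fst M" "x < y"
    then have "f x < f y" using f(1) by (simp add: strict_mono_onD)
    then show "F x < F y" using F xy by (blast intro: block_less)
  qed
  moreover have "F ` fst M \<subseteq> {..<n * g}"
  proof clarsimp
    fix v assume v: "v \<in> fst M"
    then have "f v < n" using f(2) by auto
    then show "F v < n * g" using F(2)[OF v] by (blast intro: block_less)
  qed
  moreover have "c (F ` A) = i" if A: "A \<in> snd M" for A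
  proof -
    have "F ` A = u (f ` A) ` f ` A"
      using E_eq[OF _ A] by (auto simp: F_def image_comp intro!: image_cong)
    then show ?thesis using f(3) A edge[OF A] by (auto simp: d_def)
  qed
  ultimately have "has_copy c i M (n * g)"
    unfolding has_copy_def by (intro exI[of _ F]) simp
  then show "\<exists>i \<in> {1..t}. has_copy c i M (n * g)" using i by blast
qed

section \<open>Gaps for further vertices, and crossing edges\<close>

text \<open>Stretching \<open>\<phi>\<close> by \<open>L\<close> opens gaps. A point outside
  \<open>V\<close> goes into the gap after the last point \<open>v x\<close> of \<open>V\<close>
  before it; points preceding all of \<open>V\<close> go just before the image of
  \<open>Min V\<close>. On \<open>V\<close> the result is affine in \<open>\<phi>\<close> with an
  offset known before \<open>\<phi>\<close>, so a colouring can be pulled back along this affine map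
  first and \<open>\<phi>\<close> found afterwards.\<close>

lemma spread_embedding:
  fixes \<phi> :: "nat \<Rightarrow> nat"
  assumes V: "V \<subseteq> {a..b}" "V \<noteq> {}" and L: "b - a < L"
    and \<phi>: "strict_mono_on V \<phi>" "\<phi> ` V \<subseteq> {..<m}"
  shows "\<exists>f. strict_mono_on {a..b} f \<and> f ` {a..b} \<subseteq> {..<L * m} \<and>
    (\<forall>x \<in> V. f x = L * \<phi> x + (Min V - a))"
proof -
  have fin: "finite V" using V finite_subset by blast
  have mV: "Min V \<in> V" "Min V \<ge> a" using fin V by (auto simp: subset_iff)
  define v where "v x = Max (insert (Min V) {u \<in> V. u \<le> x})" for x
  have v_in: "v x \<in> insert (Min V) {u \<in> V. u \<le> x}" for x
    unfolding v_def using fin by (intro Max_in) auto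
  then have vV: "v x \<in> V" for x using mV(1) by (metis (mono_tags, lifting) insertE mem_Collect_eq)
  have v_ge: "Min V \<le> v x" for x unfolding v_def using fin by simp
  have v_mono: "v x \<le> v y" if "x \<le> y" for x y
    unfolding v_def using fin that by (intro Max_mono) auto
  have v_id: "v x = x" if "x \<in> V" for x
    unfolding v_def using fin that by (intro Max_eqI) auto
  \<comment> \<open>The distance from \<open>v x\<close>, plus room for the points of
    \<open>{a..b}\<close> before \<open>V\<close>. The subtraction of \<open>v x\<close> does not
    truncate for \<open>a \<le> x\<close>, and since \<open>Min V \<le> v x\<close> the value is at
    most \<open>b - a\<close> or less than \<open>L\<close> in any case.\<close>
  define s where "s x = Min V - a + x - v x" for x
  have vs: "v x + s x = Min V - a + x" if "a \<le> x" for x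
    using v_in[of x] mV(2) that by (auto simp: s_def)
  have sL: "s x < L" if "x \<in> {a..b}" for x
    using vs[of x] v_ge[of x] mV(2) L that by auto
  define f where "f x = L * \<phi> (v x) + s x" for x
  have "strict_mono_on {a..b} f"
  proof (rule strict_mono_onI)
    fix x y assume xy: "x \<in> {a..b}" "y \<in> {a..b}" "x < y"
    show "f x < f y"
    proof (cases "v x = v y")
      case True
      then show ?thesis using vs[of x] vs[of y] xy by (simp add: f_def)
    next
      case False
      then have "v x < v y" using v_mono[of x y] xy by simp
      then have "\<phi> (v x) < \<phi> (v y)" using \<phi>(1) vV by (simp add: strict_mono_onD)
      then show ?thesis
        using sL[OF xy(1)] block_less[of "\<phi> (v x)" "\<phi> (v y)" "f x" L "f y"]
        by (simp add: f_def mult.commute)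
    qed
  qed
  moreover have "f ` {a..b} \<subseteq> {..<L * m}"
  proof (rule image_subsetI)
    fix x assume x: "x \<in> {a..b}"
    have "\<phi> (v x) < m" using \<phi>(2) vV by auto
    then have "f x < m * L"
      using sL[OF x] block_less[of "\<phi> (v x)" m "f x" L "m * L"]
      by (simp add: f_def mult.commute)
    then show "f x \<in> {..<L * m}" by (simp add: mult.commute)
  qed
  moreover have "\<forall>x \<in> V. f x = L * \<phi> x + (Min V - a)"
    using v_id by (simp add: f_def s_def)
  ultimately show ?thesis by blast
qed

text \<open>An edge of \<open>k\<close> vertices meeting \<open>k\<close> disjoint intervals has
  exactly one vertex in each, by counting.\<close>

lemma crossing_edge_transversal:
  assumes "card A = k" and "k \<ge> 1" and disj: "disjoint_family_on I {1..k}"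
    and "\<forall>j \<in> {1..k}. A \<inter> I j \<noteq> {}"
  obtains a where "\<And>j. j \<in> {1..k} \<Longrightarrow> a j \<in> A \<inter> I j" "A = a ` {1..k}"
proof -
  have "\<forall>j \<in> {1..k}. \<exists>x. x \<in> A \<inter> I j" using assms(4) by blast
  from bchoice[OF this] obtain a where a: "\<And>j. j \<in> {1..k} \<Longrightarrow> a j \<in> A \<inter> I j" by blast
  have "finite A" using assms(1,2) by (intro card_ge_0_finite) simp
  moreover have "inj_on a {1..k}"
  proof (rule inj_onI)
    fix i j assume ij: "i \<in> {1..k}" "j \<in> {1..k}" "a i = a j"
    then show "i = j" using a[of i] a[of j] disjoint_family_onD[OF disj, of i j] by auto
  qed
  ultimately have "A = a ` {1..k}"
    using assms(1) a by (intro card_subset_eq[symmetric]) (auto simp: card_image)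
  with a show ?thesis by (rule that)
qed

section \<open>Induction over the nested structure\<close>

text \<open>Only the red target \<open>M'\<close> shrinks in the induction. \<open>M\<close>, the
  target of the other colours, and \<open>n\<close> stay fixed, while \<open>c\<close> varies
  because it is pulled back into blocks.\<close>

lemma nestable_copy:
  assumes "nestable k M'" and "k \<ge> 2" and "k * card (snd M') \<le> n" and "range c \<subseteq> {1..Suc t}"
    and arr: "arrows t M n" "ordered_matching k e M" "t \<ge> 1"
  shows "has_copy c (Suc t) M' (n ^ (2 * card (snd M') - 1)) \<or>
    (\<exists>i \<in> {1..t}. has_copy c i M (n ^ (2 * card (snd M') - 1)))"
  using assms(1,3,4)
proof (induction M' arbitrary: c rule: nestable.induct)
  case (nestableI e' M' I)
  note OM = nestableI.hyps(1) and c = nestableI.prems(2)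
  have V: "fst M' = {1..k * e'}" and P: "partition_on {1..k * e'} (snd M')"
    and Ak: "\<And>A. A \<in> snd M' \<Longrightarrow> card A = k" and ce: "card (snd M') = e'"
    using OM by (auto simp: ordered_matching_def)
  have UF: "\<Union>(snd M') = {1..k * e'}" using P by (simp add: partition_on_def)
  have Iint: "\<And>j. j \<in> {1..k} \<Longrightarrow> \<exists>a b. I j = {a..b}"
    and Idisj: "disjoint_family_on I {1..k}"
    and Iord: "\<And>i j x y. i \<in> {1..k} \<Longrightarrow> j \<in> {1..k} \<Longrightarrow> i < j \<Longrightarrow> x \<in> I i \<Longrightarrow> y \<in> I j \<Longrightarrow> x < y"
    and IU: "(\<Union>j \<in> {1..k}. I j) = {1..k * e'}"
    using nestableI.hyps(2) unfolding consecutive_intervals_def by blast+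
  have k1: "1 \<in> {1..k}" "k \<in> {1..k}" using \<open>k \<ge> 2\<close> by auto
  \<comment> \<open>The condition on \<open>I 1\<close> excludes the empty matching, so the exponent
    \<open>2 * e' - 1\<close> is not truncated.\<close>
  have "1 \<in> {1..k * e'}" using nestableI.hyps(3) IU k1 by blast
  then have e1: "e' \<ge> 1" by (cases e') auto
  have fin: "finite (snd M')" using ce e1 by (intro card_ge_0_finite) simp
  have n1: "n \<ge> k" "n \<ge> 1" "k * e' \<le> n"
  proof -
    show "k * e' \<le> n" using nestableI.prems(1) ce by simp
    moreover have "k \<le> k * e'" using e1 by simp
    ultimately show "n \<ge> k" by linarith
    then show "n \<ge> 1" using \<open>k \<ge> 2\<close> by linarith
  qed
  \<comment> \<open>The block length: one of the factors \<open>n\<close> is spent on having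
    \<open>n\<close> blocks.\<close>
  define g where "g = n ^ (2 * e' - 2)"
  have "2 * e' - 1 = Suc (2 * e' - 2)" using e1 by simp
  then have N: "n ^ (2 * card (snd M') - 1) = n * g" using ce by (simp add: g_def)
  define F where "F j = {A \<in> snd M'. A \<subseteq> I j}" for j
  \<comment> \<open>The first and the last vertex lie in \<open>I 1\<close> and \<open>I k\<close>,
    which are disjoint as \<open>k \<ge> 2\<close>. Hence each interval misses a vertex, and its
    inner matching misses an edge.\<close>
  have not_all: "\<not> {1..k * e'} \<subseteq> I j" if j: "j \<in> {1..k}" for j
  proof
    assume "{1..k * e'} \<subseteq> I j"
    moreover have "1 \<in> {1..k * e'}" "k * e' \<in> {1..k * e'}" using e1 \<open>k \<ge> 2\<close> by auto
    ultimately have "1 \<in> I j" "k * e' \<in> I j" by blast+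
    then have "j = 1" "j = k"
      using nestableI.hyps(3,4) k1 j disjoint_family_onD[OF Idisj] by blast+
    then show False using \<open>k \<ge> 2\<close> by simp
  qed
  have Fcard: "card (F j) \<le> e' - 1" if j: "j \<in> {1..k}" for j
  proof -
    have "F j \<noteq> snd M'" using not_all[OF j] UF unfolding F_def by blast
    then have "F j \<subset> snd M'" by (auto simp: F_def)
    then have "card (F j) < e'" using psubset_card_mono[OF fin] ce by blast
    then show ?thesis by simp
  qed
  show ?case
  proof (cases "\<exists>i \<in> {1..t}. has_copy c i M (n * g)")
    case True
    then show ?thesis using N by simp
  next
    case no_copy: False
    then obtain Q where Q: "Q \<subseteq> {..<n}" "card Q = k"
      and red: "\<And>u. (\<forall>q \<in> Q. u q \<in> {q * g..<Suc q * g}) \<Longrightarrow> c (u ` Q) = Suc t"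
      using red_blocks_or_copy[OF c arr, of g] by blast
    have finQ: "finite Q" using Q(1) finite_subset by blast
    have rQ: "rank_in Q ` Q = {1..k}" using rank_in_image[OF finQ] Q(2) by simp
    \<comment> \<open>\<open>q j\<close> is the \<open>j\<close>-th smallest block of
      \<open>Q\<close>, the one that will receive \<open>I j\<close>.\<close>
    define q where "q = inv_into Q (rank_in Q)"
    have q: "q j \<in> Q" "rank_in Q (q j) = j" if "j \<in> {1..k}" for j
      using that rQ unfolding q_def by (metis inv_into_into, metis f_inv_into_f)
    have qr: "q (rank_in Q p) = p" "rank_in Q p \<in> {1..k}" if "p \<in> Q" for p
      using that rQ strict_mono_on_imp_inj_on[OF strict_mono_on_rank_in[OF finQ]]
      unfolding q_def by (auto simp: inv_into_f_f)
    have q_less: "q i < q j" if "i \<in> {1..k}" "j \<in> {1..k}" "i < j" for i j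
      using strict_mono_on_less[OF strict_mono_on_rank_in[OF finQ]] q that by metis
    \<comment> \<open>All of \<open>I j\<close> is embedded, not only the vertices of
      \<open>F j\<close>: the crossing edges need places in the block too.\<close>
    have inner: "\<exists>f. strict_mono_on (I j) f \<and> f ` I j \<subseteq> {q j * g..<Suc (q j) * g} \<and>
        (\<forall>A \<in> F j. c (f ` A) = Suc t)" if j: "j \<in> {1..k}" for j
    proof -
      obtain a b where ab: "I j = {a..b}" using Iint[OF j] by blast
      have Isub: "{a..b} \<subseteq> {1..k * e'}" using IU j ab by blast
      have abn: "b - a < n"
      proof (cases "a \<le> b")
        case True
        then have "a \<ge> 1" "b \<le> k * e'" using Isub by auto
        then show ?thesis using n1 True by linarith
      qed (use n1 in simp)
      have "\<exists>f. strict_mono_on (I j) f \<and> f ` I j \<subseteq> {..<g} \<and>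
        (\<forall>A \<in> F j. c ((\<lambda>x. q j * g + x) ` f ` A) = Suc t)"
      proof (cases "F j = {}")
        case True
        \<comment> \<open>With no inner edges it suffices that \<open>I j\<close> fits into the
          block. For \<open>e' = 1\<close> the block is a single point, but then the only edge is
          crossing and \<open>I j\<close> has at most one point; for larger \<open>e'\<close>
          already \<open>n \<le> g\<close>.\<close>
        have "b - a < g"
        proof (cases "e' = 1")
          case True
          then obtain A where A: "snd M' = {A}" using ce by (meson card_1_singletonE)
          then have Aeq: "A = {1..k * e'}" using UF by simp
          then have "\<forall>j \<in> {1..k}. A \<inter> I j \<noteq> {}"
            using nestableI.hyps(5)[of A] A not_all by blast
          then obtain p where p: "\<And>j. j \<in> {1..k} \<Longrightarrow> p j \<in> A \<inter> I j" and Ap: "A = p ` {1..k}"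
            using crossing_edge_transversal[OF _ _ Idisj, of A] Ak A \<open>k \<ge> 2\<close> by auto
          have "x = p j" if x: "x \<in> I j" for x
          proof -
            have "x \<in> A" using x Isub ab Aeq by blast
            then obtain i where i: "i \<in> {1..k}" "x = p i" using Ap by blast
            then have "i = j" using x p[OF i(1)] j disjoint_family_onD[OF Idisj, of i j] by blast
            then show ?thesis using i by simp
          qed
          then have "b = a" if "a \<le> b" using that ab by (metis atLeastAtMost_iff order_refl)
          then have "b \<le> a" by linarith
          then show ?thesis using n1 by (simp add: g_def)
        next
          case False
          then have "n ^ 1 \<le> g" unfolding g_def using e1 n1 by (intro power_increasing) auto
          then show ?thesis using abn by simp
        qed
        then show ?thesis
          using True unfolding ab
          by (intro exI[of _ "\<lambda>x. x - a"]) (auto simp: strict_mono_on_def)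
      next
        case False
        let ?G = "relabel (F j)"
        define m where "m = n ^ (2 * card (snd ?G) - 1)"
        have finF: "finite (\<Union>(F j))" using UF finite_subset[of "\<Union>(F j)" "{1..k * e'}"]
          by (auto simp: F_def)
        have "card (snd ?G) \<le> card (F j)"
          using fin by (simp add: relabel_def F_def card_image_le)
        then have Ge: "card (snd ?G) \<le> e' - 1" using Fcard[OF j] by simp
        have "k * card (snd ?G) \<le> k * e'" using Ge by (intro mult_le_mono2) simp
        then have Gn: "k * card (snd ?G) \<le> n" using n1(3) by (rule le_trans)
        have "snd ?G \<noteq> {}" using False by (simp add: relabel_def)
        moreover have "finite (snd ?G)" using fin by (simp add: relabel_def F_def)
        ultimately have "card (snd ?G) \<ge> 1" by (simp add: Suc_le_eq card_gt_0_iff)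
        then have "Suc (2 * card (snd ?G) - 1) = 2 * card (snd ?G)" by simp
        \<comment> \<open>The second factor \<open>n\<close> pays for the gaps: at most
          \<open>e' - 1\<close> inner edges give the exponent
          \<open>1 + (2 * (e' - 1) - 1) = 2 * e' - 2\<close>, that of \<open>g\<close>.\<close>
        then have "n * m = n ^ (2 * card (snd ?G))"
          unfolding m_def by (metis power_Suc)
        also have "\<dots> \<le> g" unfolding g_def using Ge n1 by (intro power_increasing) auto
        finally have nm: "n * m \<le> g" .
        define V where "V = \<Union>(F j)"
        have VI: "V \<subseteq> {a..b}" unfolding V_def using ab by (auto simp: F_def)
        have "\<forall>A \<in> F j. card A = k" using Ak by (auto simp: F_def)
        then have "\<forall>A \<in> F j. A \<noteq> {}" using \<open>k \<ge> 2\<close> by fastforce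
        then have Vne: "V \<noteq> {}" unfolding V_def using False by blast
        define r where "r = Min V - a"
        have rn: "r < n"
        proof -
          have "Min V \<in> V" using Vne finF V_def by (intro Min_in) auto
          then have "Min V \<in> {a..b}" using VI by blast
          then show ?thesis using abn unfolding r_def atLeastAtMost_iff by linarith
        qed
        \<comment> \<open>\<open>h\<close> anticipates the final position of a vertex that
          \<open>\<phi>\<close> sends to \<open>x\<close>: block \<open>q j\<close>, gap width
          \<open>n\<close>, offset \<open>r\<close> from the spreading.\<close>
        define h where "h x = q j * g + (n * x + r)" for x
        have h_mono: "strict_mono_on {..<m} h"
          using n1 by (auto simp: strict_mono_on_def h_def)
        have h_img: "h ` {..<m} \<subseteq> {..<n * g}"
        proof (rule image_subsetI)
          fix x assume "x \<in> {..<m}"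
          then have "n * x + r < m * n"
            using rn block_less[of x m "n * x + r" n "m * n"] by (simp add: mult.commute)
          then have "h x < Suc (q j) * g" using nm by (simp add: h_def mult.commute)
          moreover have "q j < n" using q(1)[OF j] Q(1) by blast
          ultimately show "h x \<in> {..<n * g}" using block_less[of "q j" n "h x" g "n * g"] by simp
        qed
        have "has_copy (\<lambda>A. c (h ` A)) (Suc t) ?G m \<or>
            (\<exists>i \<in> {1..t}. has_copy (\<lambda>A. c (h ` A)) i M m)"
        proof -
          have "range (\<lambda>A. c (h ` A)) \<subseteq> {1..Suc t}" using c by auto
          then show ?thesis
            using nestableI.IH[OF j] False Gn unfolding F_def[symmetric] m_def by blast
        qed
        \<comment> \<open>A copy of \<open>M\<close> in another colour would be carried by
          \<open>h\<close> into the whole segment, against \<open>no_copy\<close>.\<close>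
        then have "has_copy (\<lambda>A. c (h ` A)) (Suc t) ?G m"
          using no_copy has_copy_pullback[OF _ h_mono h_img] by blast
        then have "has_copy (\<lambda>A. c (h ` A)) (Suc t) (V, F j) m"
          unfolding V_def using finF by (rule has_copy_relabelD)
        then obtain \<phi> where \<phi>: "strict_mono_on V \<phi>" "\<phi> ` V \<subseteq> {..<m}"
            "\<forall>A \<in> F j. c (h ` \<phi> ` A) = Suc t"
          by (auto simp: has_copy_def)
        obtain f where f: "strict_mono_on {a..b} f" "f ` {a..b} \<subseteq> {..<n * m}"
            "\<forall>x \<in> V. f x = n * \<phi> x + r"
          using spread_embedding[OF VI Vne abn \<phi>(1,2)] unfolding r_def by blast
        have "(\<lambda>x. q j * g + x) ` f ` A = h ` \<phi> ` A" if "A \<in> F j" for A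
          unfolding image_image
        proof (rule image_cong)
          fix x assume "x \<in> A"
          then have "x \<in> V" using that by (auto simp: V_def)
          then show "q j * g + f x = h (\<phi> x)" using f(3) by (simp add: h_def)
        qed simp
        then show ?thesis
          using f(1,2) nm \<phi>(3) unfolding ab by (intro exI[of _ f]) fastforce
      qed
      then obtain f where f: "strict_mono_on (I j) f" "f ` I j \<subseteq> {..<g}"
          "\<forall>A \<in> F j. c ((\<lambda>x. q j * g + x) ` f ` A) = Suc t" by blast
      show ?thesis
      proof (intro exI[of _ "\<lambda>x. q j * g + f x"] conjI)
        show "strict_mono_on (I j) (\<lambda>x. q j * g + f x)"
          using f(1) by (simp add: strict_mono_on_def)
        show "(\<lambda>x. q j * g + f x) ` I j \<subseteq> {q j * g..<Suc (q j) * g}" using f(2) by auto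
        show "\<forall>A \<in> F j. c ((\<lambda>x. q j * g + f x) ` A) = Suc t" using f(3) by (simp add: image_image)
      qed
    qed
    then obtain f where f_mono: "\<And>j. j \<in> {1..k} \<Longrightarrow> strict_mono_on (I j) (f j)"
      and f_img: "\<And>j. j \<in> {1..k} \<Longrightarrow> f j ` I j \<subseteq> {q j * g..<Suc (q j) * g}"
      and f_red: "\<And>j A. j \<in> {1..k} \<Longrightarrow> A \<in> F j \<Longrightarrow> c (f j ` A) = Suc t"
      by metis
    have "\<exists>j. j \<in> {1..k} \<and> x \<in> I j" if "x \<in> {1..k * e'}" for x
      using IU that by blast
    then obtain J where J: "\<And>x. x \<in> {1..k * e'} \<Longrightarrow> J x \<in> {1..k} \<and> x \<in> I (J x)" by metis
    have J_eq: "J x = j" if "j \<in> {1..k}" "x \<in> I j" for x j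
    proof -
      have "x \<in> {1..k * e'}" using IU that by blast
      then show ?thesis using J[of x] that disjoint_family_onD[OF Idisj, of "J x" j] by blast
    qed
    \<comment> \<open>The embeddings of the intervals are glued; \<open>J x\<close> is the index of
      the interval containing \<open>x\<close>.\<close>
    define \<psi> where "\<psi> x = f (J x) x" for x
    have \<psi>: "\<psi> x \<in> {q j * g..<Suc (q j) * g}" if "j \<in> {1..k}" "x \<in> I j" for x j
      using f_img[OF that(1)] J_eq[OF that] that(2) by (auto simp: \<psi>_def)
    have "strict_mono_on {1..k * e'} \<psi>"
    proof (rule strict_mono_onI)
      fix x y assume xy: "x \<in> {1..k * e'}" "y \<in> {1..k * e'}" "x < y"
      note Jx = J[OF xy(1)] and Jy = J[OF xy(2)]
      show "\<psi> x < \<psi> y"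
      proof (cases "J x = J y")
        case True
        then show ?thesis
          using f_mono[of "J x"] Jx Jy xy(3) unfolding \<psi>_def by (metis strict_mono_onD)
      next
        case False
        then have "J x < J y" using Iord[of "J y" "J x" y x] Jx Jy xy(3) by fastforce
        then have "q (J x) < q (J y)" using q_less Jx Jy by blast
        then show ?thesis using \<psi>[of "J x" x] \<psi>[of "J y" y] Jx Jy block_less[of "q (J x)" "q (J y)" "\<psi> x" g "\<psi> y"]
          by simp
      qed
    qed
    moreover have "\<psi> ` {1..k * e'} \<subseteq> {..<n * g}"
    proof (rule image_subsetI)
      fix x assume x: "x \<in> {1..k * e'}"
      then have "q (J x) < n" using q(1) Q(1) J by blast
      then show "\<psi> x \<in> {..<n * g}" 
        using \<psi>[of "J x" x] J[OF x] block_less[of "q (J x)" n "\<psi> x" g "n * g"] by simp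
    qed
    moreover have "c (\<psi> ` A) = Suc t" if A: "A \<in> snd M'" for A
    proof (cases "\<exists>j \<in> {1..k}. A \<subseteq> I j")
      case True
      then obtain j where j: "j \<in> {1..k}" "A \<subseteq> I j" by blast
      then have "\<psi> ` A = f j ` A" using J_eq by (intro image_cong) (auto simp: \<psi>_def)
      then show ?thesis using f_red[OF j(1)] j A by (simp add: F_def)
    next
      case False
      then have "\<forall>j \<in> {1..k}. A \<inter> I j \<noteq> {}" using nestableI.hyps(5)[OF A] by blast
      then obtain p where p: "\<And>j. j \<in> {1..k} \<Longrightarrow> p j \<in> A \<inter> I j" and Ap: "A = p ` {1..k}"
        using crossing_edge_transversal[OF Ak[OF A] _ Idisj] \<open>k \<ge> 2\<close> by auto
      \<comment> \<open>The image of a crossing edge, indexed by the blocks of \<open>Q\<close>: it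
        has one vertex in each of them, so it is red whatever the positions within the
        blocks.\<close>
      define u where "u z = \<psi> (p (rank_in Q z))" for z
      have "u z \<in> {z * g..<Suc z * g}" if "z \<in> Q" for z
        using \<psi>[OF qr(2)[OF that]] p[OF qr(2)[OF that]] qr(1)[OF that] by (auto simp: u_def)
      then have "c (u ` Q) = Suc t" using red by blast
      moreover have "u ` Q = \<psi> ` p ` rank_in Q ` Q" by (auto simp: u_def)
      ultimately show ?thesis using Ap rQ by simp
    qed
    ultimately have "has_copy c (Suc t) M' (n * g)" unfolding has_copy_def V by blast
    then show ?thesis using N by simp
  qed
qed

section \<open>Induction on the number of colours and the final bound\<close>

lemma arrows_nestable:
  assumes "k \<ge> 2" "e \<ge> 1" and M: "ordered_matching k e M" "nestable k M"
  shows "arrows (Suc t) M ((e * k) ^ ((2 * e - 1) ^ t))"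
proof (induction t)
  case 0
  have "has_copy c 1 M (e * k)" if "range c \<subseteq> {1..Suc 0}" for c
    unfolding has_copy_def
  proof (intro exI[of _ "\<lambda>x. x - 1"] conjI ballI)
    show "strict_mono_on (fst M) (\<lambda>x. x - 1)"
      using M(1) by (auto simp: ordered_matching_def strict_mono_on_def)
    show "(\<lambda>x. x - 1) ` fst M \<subseteq> {..<e * k}"
      using M(1) by (auto simp: ordered_matching_def mult.commute)
    show "c ((\<lambda>x. x - 1) ` A) = 1" for A using that by (force simp: image_subset_iff)
  qed
  then show ?case by (simp add: arrows_def)
next
  case (Suc t)
  let ?n = "(e * k) ^ ((2 * e - 1) ^ t)"
  have ce: "card (snd M) = e" using M(1) by (simp add: ordered_matching_def)
  have "(e * k) ^ 1 \<le> ?n" using assms(1,2) by (intro power_increasing) auto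
  then have "k * card (snd M) \<le> ?n" by (simp add: ce mult.commute)
  \<comment> \<open>Here \<open>M\<close> is the target in every colour, red included. Each
    additional colour raises the bound to the power \<open>2 * e - 1\<close>.\<close>
  from nestable_copy[OF M(2) assms(1) this _ Suc M(1)]
  have "arrows (Suc (Suc t)) M (?n ^ (2 * e - 1))"
    unfolding arrows_def ce by fastforce
  then show ?case by (simp add: power_mult[symmetric] mult.commute)
qed

theorem theorem14:
  fixes k e t :: nat and M :: "nat hypergraph"
  assumes "k \<ge> 3" and "e \<ge> 2" and "t \<ge> 1"
    and "ordered_matching k e M" and "nestable k M"
  shows "ordered_ramsey k t M \<le> (e * k) ^ ((2 * e - 1) ^ (t - 1)) \<and>
    real ((e * k) ^ ((2 * e - 1) ^ (t - 1))) =
      2 powr ((2 * real e - 1) ^ (t - 1) * log 2 (real (e * k)))"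
proof
  have "arrows t M ((e * k) ^ ((2 * e - 1) ^ (t - 1)))"
    using arrows_nestable[of k e M "t - 1"] assms by simp
  then show "ordered_ramsey k t M \<le> (e * k) ^ ((2 * e - 1) ^ (t - 1))"
    unfolding ordered_ramsey_def using assms by (intro Least_le ramsey_arrow_if_arrows)
next
  let ?y = "(2 * e - 1) ^ (t - 1)"
  have ek: "real (e * k) > 0" using assms by simp
  \<comment> \<open>The natural-number subtraction agrees with the real one because \<open>e\<close>
    is positive.\<close>
  have "(2 * real e - 1) ^ (t - 1) = real ?y" using assms by (simp add: of_nat_diff)
  then have "2 powr ((2 * real e - 1) ^ (t - 1) * log 2 (real (e * k))) =
      (2 powr log 2 (real (e * k))) powr real ?y"
    by (simp only: powr_powr mult.commute)
  also have "\<dots> = real (e * k) powr real ?y" using ek by simp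
  also have "\<dots> = real ((e * k) ^ ?y)"
    unfolding of_nat_power[of _ ?y] using ek by (rule powr_realpow)
  finally show "real ((e * k) ^ ?y) =
      2 powr ((2 * real e - 1) ^ (t - 1) * log 2 (real (e * k)))" by (rule sym)
qed

end
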